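(* Let $n,k$ be integers with $1\leq k\leq n-3$. Let $z$ be the pendant vertex of $L_{n,n-k}$ and let $G\in\mathfrak{C}_{n,k}$. Then $D_G(v)\leq D_{L_{n,n-k}}(z)$ for every $v\in V(G)$.
   Context: All graphs are simple, finite, connected and undirected. A cut vertex of a graph is a vertex whose removal makes the graph disconnected; a pendant vertex is a vertex of degree one. $\mathfrak{C}_{n,k}$ denotes the set of all connected graphs on $n$ vertices with exactly $k$ cut vertices. For vertices $u,v$ of $G$, $d(u,v)$ is the number of edges of a shortest path joining $u$ and $v$, and the distance of a vertex $v$ in $G$ is $D_G(v)=\sum_{u\in V(G)}d(v,u)$. $P_m$ and $C_m$ are the path and the cycle on $m$ vertices. For $3\leq g\leq n-1$, $L_{n,g}$ is the graph on $n$ vertices obtained by identifying a pendant vertex of the path $P_{n-g+1}$ with a vertex of the cycle $C_g$; it has exactly $n-g$ cut vertices and exactly one pendant vertex. *)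

theory Defs
  imports "Graph_Theory.Graph_Theory"
begin

text \<open>
  A simple finite undirected graph is a \<open>pair_graph\<close>: finite vertex set and a symmetric,
  irreflexive arc relation, so an edge $uv$ is the pair of arcs $(u,v)$, $(v,u)$.
\<close>

text \<open>
  The library does not regard the null graph as connected; the first inequality keeps
  the vertex of the one-vertex graph from counting as a cut vertex.
\<close>
definition cut_vertex :: "'a pair_pre_digraph \<Rightarrow> 'a \<Rightarrow> bool" where
  "cut_vertex G v \<longleftrightarrow>
     v \<in> pverts G \<and> pverts G \<noteq> {v} \<and> \<not> connected (pre_digraph.del_vert (with_proj G) v)"

text \<open>By symmetry the out-degree is the degree in the undirected sense.\<close>
definition pendant_vertex :: "'a pair_pre_digraph \<Rightarrow> 'a \<Rightarrow> bool" where
  "pendant_vertex G v \<longleftrightarrow> v \<in> pverts G \<and> out_degree (with_proj G) v = 1"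

definition conn_graphs :: "nat \<Rightarrow> nat \<Rightarrow> 'a pair_pre_digraph set" where
  "conn_graphs n k =
     {G. pair_graph G \<and> connected (with_proj G) \<and> card (pverts G) = n
         \<and> card {v. cut_vertex G v} = k}"

definition graph_dist :: "'a pair_pre_digraph \<Rightarrow> 'a \<Rightarrow> 'a \<Rightarrow> nat" where
  "graph_dist G u v = (LEAST l. \<exists>p. pre_digraph.apath (with_proj G) u p v \<and> length p = l)"

lemma (in pair_graph) graph_dist_eq_mu:
  assumes "u \<rightarrow>\<^sup>*\<^bsub>with_proj G\<^esub> v"
  shows "ereal (real (graph_dist G u v)) = \<mu> (\<lambda>_. 1) u v"
proof -
  have cost: "awalk_cost (\<lambda>_. 1) p = real (length p)" for p :: "('a \<times> 'a) list"
    by (induct p) auto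
  obtain p where p: "apath u p v" "\<mu> (\<lambda>_. 1) u v = awalk_cost (\<lambda>_. 1) p"
    using min_cost_awalk[OF assms, of "\<lambda>_. 1"] by auto
  have "graph_dist G u v = length p"
    unfolding graph_dist_def
  proof (rule Least_equality)
    fix l assume "\<exists>q. apath u q v \<and> length q = l"
    then obtain q where q: "awalk u q v" "length q = l" by (auto simp: apath_def)
    then show "length p \<le> l"
      using min_cost_le_walk_cost[OF q(1), of "\<lambda>_. 1"] p(2) cost by simp
  qed (use p in auto)
  then show ?thesis using p cost by simp
qed

definition vertex_distance :: "'a pair_pre_digraph \<Rightarrow> 'a \<Rightarrow> nat" where
  "vertex_distance G v = (\<Sum>u\<in>pverts G. graph_dist G v u)"

definition path_graph :: "nat \<Rightarrow> nat pair_pre_digraph" where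
  "path_graph m =
     \<lparr> pverts = {..<m}, parcs = {(i, j). i < m \<and> j < m \<and> (j = i + 1 \<or> i = j + 1)} \<rparr>"

text \<open>Meaningful for \<open>m \<ge> 3\<close> (for \<open>m = 1\<close> there is a loop).\<close>
definition cycle_graph :: "nat \<Rightarrow> nat pair_pre_digraph" where
  "cycle_graph m =
     \<lparr> pverts = {..<m},
       parcs = {(i, j). i < m \<and> j < m \<and> (j = (i + 1) mod m \<or> i = (j + 1) mod m)} \<rparr>"

text \<open>Disjoint union of \<open>G\<close> and \<open>H\<close> with the vertex \<open>v\<close> of \<open>H\<close> merged into the vertex \<open>u\<close> of \<open>G\<close>.\<close>
definition identify_vertices ::
  "'a pair_pre_digraph \<Rightarrow> 'a \<Rightarrow> 'b pair_pre_digraph \<Rightarrow> 'b \<Rightarrow> ('a + 'b) pair_pre_digraph" where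
  "identify_vertices G u H v =
     (let h = Inr(v := Inl u) in
      \<lparr> pverts = Inl ` pverts G \<union> h ` pverts H,
        parcs = map_prod Inl Inl ` parcs G \<union> map_prod h h ` parcs H \<rparr>)"

text \<open>
  Vertex \<open>0\<close> is an end of the path, and a pendant vertex of it when \<open>g < n\<close>.
  Meaningful for \<open>3 \<le> g \<le> n - 1\<close>.
\<close>
definition L_graph :: "nat \<Rightarrow> nat \<Rightarrow> (nat + nat) pair_pre_digraph" where
  "L_graph n g = identify_vertices (path_graph (n - g + 1)) 0 (cycle_graph g) 0"

lemma L_verts: assumes "3 \<le> g" "g < n"
  shows "pverts (L_graph n g) = Inl ` {..n-g} \<union> Inr ` {1..<g}"
proof -
  have "{..<g} = insert 0 {1..<g}" using assms by auto
  moreover have "(Inr(0 := Inl 0)) ` {1..<g} = Inr ` {1..<g}" by (rule image_cong) auto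
  ultimately show ?thesis using assms
  unfolding L_graph_def identify_vertices_def path_graph_def cycle_graph_def Let_def
  by (auto simp: lessThan_Suc_atMost)
qed

lemma L_arcs: assumes "3 \<le> g" "g < n"
  shows "parcs (L_graph n g) = {(a,b). (\<exists>i<n-g. (a,b)=(Inl i, Inl (i+1)) \<or> (b,a)=(Inl i, Inl (i+1)))
   \<or> (\<exists>i. 1 \<le> i \<and> i+1<g \<and> ((a,b)=(Inr i, Inr (i+1)) \<or> (b,a)=(Inr i, Inr (i+1))))
   \<or> (a,b) \<in> {(Inl 0, Inr 1), (Inr 1, Inl 0),(Inl 0, Inr (g-1)), (Inr (g-1), Inl 0)}}" (is "_ = ?R")
proof -
  have c: "{(i, j). i < g \<and> j < g \<and> (j = (i + 1) mod g \<or> i = (j + 1) mod g)}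
     = {(i,j). (1\<le>i \<and> j = i+1 \<and> i+1<g) \<or> (1\<le>j \<and> i = j+1 \<and> j+1<g) \<or> (i,j) \<in> {(0,1),(1,0),(0,g-1),(g-1,0)}}"
    (is "?A=?B")
  proof -
    have e: "(i+1) mod g = (if i+1 = g then 0 else i+1)" if "i<g" for i using that by simp
    have e': "j = (i+1) mod g \<longleftrightarrow> (i+1<g \<and> j=i+1) \<or> (i=g-1\<and>j=0)" if "i<g" for i j using e[OF that] that by auto
    have *: "(i < g \<and> j < g \<and> (j = (i + 1) mod g \<or> i = (j + 1) mod g)) \<longleftrightarrow>
        (1 \<le> i \<and> j = i + 1 \<and> i + 1 < g) \<or> (1 \<le> j \<and> i = j + 1 \<and> j + 1 < g)
        \<or> (i, j) \<in> {(0, 1), (1, 0), (0, g - 1), (g - 1, 0)}" (is "?P \<longleftrightarrow> ?Q") for i j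
    proof -
      have "?P \<longleftrightarrow> i < g \<and> j < g \<and> ((i + 1 < g \<and> j = i + 1) \<or> (i = g - 1 \<and> j = 0)
          \<or> (j + 1 < g \<and> i = j + 1) \<or> (j = g - 1 \<and> i = 0))"
      proof (cases "i < g \<and> j < g")
        case True
        then have "i < g" "j < g" by auto
        show ?thesis unfolding e'[OF \<open>i < g\<close>] e'[OF \<open>j < g\<close>] by (simp only: disj_assoc)
      qed (simp only: conj_assoc[symmetric] simp_thms)
      also have "\<dots> \<longleftrightarrow> ?Q"
        unfolding insert_iff empty_iff prod.inject using assms by presburger
      finally show ?thesis .
    qed
    show ?thesis unfolding * ..
  qed
  let ?h = "Inr(0 := Inl 0) :: nat \<Rightarrow> nat+nat"
  have 1: "map_prod ?h ?h ` ?B = {(a,b). (\<exists>i. 1 \<le> i \<and> i+1<g \<and> ((a,b)=(Inr i, Inr (i+1)) \<or> (b,a)=(Inr i, Inr (i+1))))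
   \<or> (a,b) \<in> {(Inl 0, Inr 1), (Inr 1, Inl 0),(Inl 0, Inr (g-1)), (Inr (g-1), Inl 0)}}" (is "?C = ?D")
  proof
    show "?C \<subseteq> ?D" using assms by (auto)
    show "?D \<subseteq> ?C"
    proof (clarify, elim disjE exE conjE)
      fix a b :: "nat + nat" and i assume "1 \<le> i" "i+1<g" "(a,b)=(Inr i, Inr (i+1))"
      then show "(a,b) \<in> ?C" by (intro image_eqI[of _ _ "(i,i+1)"]) auto
    next
      fix a b :: "nat + nat" and i assume "1 \<le> i" "i+1<g" "(b,a)=(Inr i, Inr (i+1))"
      then show "(a,b) \<in> ?C" by (intro image_eqI[of _ _ "(i+1,i)"]) auto
    next
      fix a b :: "nat + nat" assume "(a,b) \<in> {(Inl 0, Inr 1), (Inr 1, Inl 0),(Inl 0, Inr (g-1)), (Inr (g-1), Inl 0::nat+nat)}"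
      moreover have "(Inl 0, Inr 1) \<in> ?C" by (intro image_eqI[of _ _ "(0,1)"]) auto
      moreover have "(Inr 1, Inl 0) \<in> ?C" by (intro image_eqI[of _ _ "(1,0)"]) auto
      moreover have "(Inr (g-1), Inl 0) \<in> ?C" using assms by (intro image_eqI[of _ _ "(g-1,0)"]) auto
      moreover have "(Inl 0, Inr (g-1)) \<in> ?C" using assms by (intro image_eqI[of _ _ "(0,g-1)"]) auto
      ultimately show "(a,b) \<in> ?C" by blast
    qed
  qed
  have 2: "map_prod Inl (Inl :: nat \<Rightarrow> nat + nat) ` {(i, j). i < n - g + 1 \<and> j < n - g + 1 \<and> (j = i + 1 \<or> i = j + 1)}
    = {(a :: nat + nat, b). \<exists>i<n - g. (a, b) = (Inl i, Inl (i + 1)) \<or> (b, a) = (Inl i, Inl (i + 1))}"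
    (is "?E = ?F")
  proof
    show "?E \<subseteq> ?F" by auto
    show "?F \<subseteq> ?E"
    proof clarify
      fix a b :: "nat + nat" and i
      assume "i < n - g" "(a, b) = (Inl i, Inl (i + 1)) \<or> (b, a) = (Inl i, Inl (i + 1))"
      then show "(a, b) \<in> ?E"
        by (elim disjE; intro image_eqI[of _ _ "(projl a, projl b)"]) auto
    qed
  qed
  show ?thesis
    unfolding L_graph_def identify_vertices_def path_graph_def cycle_graph_def Let_def pair_pre_digraph.simps c 1 2
    by (rule set_eqI, simp only: Un_iff mem_Collect_eq split_paired_all prod.case)
qed

lemma pair_graph_L: assumes "3 \<le> g" "g < n" shows "pair_graph (L_graph n g)"
proof -
  have fin: "finite (pverts (L_graph n g))" using L_verts[OF assms] by simp
  have sub: "parcs (L_graph n g) \<subseteq> pverts (L_graph n g) \<times> pverts (L_graph n g)"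
    unfolding L_verts[OF assms] L_arcs[OF assms] using assms by auto
  show ?thesis
  proof
    show "finite (parcs (L_graph n g))" using finite_subset[OF sub] fin by simp
    show "symmetric (with_proj (L_graph n g))" unfolding symmetric_def sym_def
      by (simp, unfold L_arcs[OF assms], blast)
    show "e \<in> parcs (L_graph n g) \<Longrightarrow> fst e \<noteq> snd e" for e
      unfolding L_arcs[OF assms] by auto
  qed (use sub fin in auto)
qed

lemma card_L: assumes "3 \<le> g" "g < n" shows "card (pverts (L_graph n g)) = n"
  unfolding L_verts[OF assms] using assms
  by (subst card_Un_disjoint) (auto simp: card_image)

lemma out_arcs_with_proj: "out_arcs (with_proj G) a = Pair a ` {b. (a,b) \<in> parcs G}"
  by (auto simp: out_arcs_def)

lemma pendant_L: assumes "3 \<le> g" "g < n"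
  shows "pendant_vertex (L_graph n g) z \<longleftrightarrow> z = Inl (n - g)"
proof -
  have d: "out_degree (with_proj (L_graph n g)) a = card {b. (a,b) \<in> parcs (L_graph n g)}" for a
    unfolding out_degree_def out_arcs_with_proj by (rule card_image) (auto simp: inj_on_def)
  have A: "out_degree (with_proj (L_graph n g)) (Inl (n-g)) = 1"
  proof -
    have "{b. (Inl (n-g),b) \<in> parcs (L_graph n g)} = {Inl (n-g-1)}"
      unfolding L_arcs[OF assms] using assms by (auto intro!: exI[of _ "n - Suc g"])
    then show ?thesis unfolding d by simp
  qed
  have B: "out_degree (with_proj (L_graph n g)) a \<noteq> 1" if "a \<in> pverts (L_graph n g)" "a \<noteq> Inl (n-g)" for a
  proof -
    have "\<exists>b c. b \<noteq> c \<and> (a,b) \<in> parcs (L_graph n g) \<and> (a,c) \<in> parcs (L_graph n g)"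
    proof (cases a)
      case (Inl i)
      then have i: "i < n-g" using that L_verts[OF assms] by auto
      show ?thesis
      proof (cases i)
        case 0 then show ?thesis unfolding Inl L_arcs[OF assms] using assms by auto
      next
        case (Suc m)
        then have "(a, Inl m) \<in> parcs (L_graph n g)" "(a, Inl (i+1)) \<in> parcs (L_graph n g)"
          unfolding Inl L_arcs[OF assms] using i by (auto intro: exI[of _ m])
        then show ?thesis using Suc by (intro exI[of _ "Inl m"] exI[of _ "Inl (i+1)"]) auto
      qed
    next
      case (Inr j)
      then have j: "1 \<le> j" "j < g" using that L_verts[OF assms] by auto
      let ?b = "if j = 1 then Inl 0 else Inr (j-1) :: nat+nat"
      let ?c = "if j = g-1 then Inl 0 else Inr (j+1) :: nat+nat"
      have "(a, ?b) \<in> parcs (L_graph n g)" 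
        unfolding Inr L_arcs[OF assms] using j by (auto intro!: exI[of _ "j-1"])
      moreover have "(a, ?c) \<in> parcs (L_graph n g)" 
        unfolding Inr L_arcs[OF assms] using j by auto
      moreover have "?b \<noteq> ?c" using j assms by auto
      ultimately show ?thesis by blast
    qed
    then obtain b c where bc: "b \<noteq> c" "{b, c} \<subseteq> {b. (a, b) \<in> parcs (L_graph n g)}"
      by auto
    show ?thesis
    proof
      assume "out_degree (with_proj (L_graph n g)) a = 1"
      then obtain x where "{b. (a, b) \<in> parcs (L_graph n g)} = {x}"
        unfolding d by (rule card_1_singletonE)
      with bc show False by simp
    qed
  qed
  have "Inl (n-g) \<in> pverts (L_graph n g)" using L_verts[OF assms] by auto
  then show ?thesis using A B unfolding pendant_vertex_def by blast
qed

lemma ex1_pendant_L: "3 \<le> g \<Longrightarrow> g < n \<Longrightarrow> \<exists>!z. pendant_vertex (L_graph n g) z"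
  by (simp add: pendant_L)
end

theory Submission
  imports Defs
begin

text \<open>
  Sort the vertices of \<open>G\<close> into layers by their distance from \<open>v\<close>. If a layer
  that is neither the first nor the last consists of one vertex, this is a cut vertex, so at most \<open>k\<close> of the inner
  layers are singletons. If some vertex lies beyond distance \<open>j\<close>, there are hence at least
  \<open>j + 1 + (j - k)\<close> vertices (truncated subtraction) within distance \<open>j\<close> of \<open>v\<close>. In
  \<open>L\<^sub>n\<^sub>,\<^sub>n\<^sub>-\<^sub>k\<close> at most that many vertices are within distance \<open>j\<close> of \<open>z\<close>: the path contributes
  singletons up to distance \<open>k\<close>, and the cycle then contributes pairs. Summing over \<open>j\<close> the
  numbers of vertices beyond distance \<open>j\<close> gives the claim.
\<close>

section \<open>Sums of distances through counts of vertices beyond each threshold\<close>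

lemma sum_eq_sum_card_less:
  fixes d :: "'a \<Rightarrow> nat"
  assumes "finite V" "\<And>x. x \<in> V \<Longrightarrow> d x \<le> M"
  shows "sum d V = (\<Sum>j<M. card {x \<in> V. j < d x})"
proof -
  have "d x = (\<Sum>j<M. if j < d x then 1 else 0)" if "x \<in> V" for x
  proof -
    have "{..<M} \<inter> {j. j < d x} = {..<d x}" using assms(2)[OF that] by auto
    then show ?thesis by (simp add: sum.If_cases)
  qed
  then have "sum d V = (\<Sum>x\<in>V. \<Sum>j<M. if j < d x then 1 else 0)" by (rule sum.cong[OF refl])
  also have "\<dots> = (\<Sum>j<M. \<Sum>x\<in>V. if j < d x then 1 else 0)" by (rule sum.swap)
  also have "\<dots> = (\<Sum>j<M. card {x \<in> V. j < d x})"
  proof -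
    have "V \<inter> {x. j < d x} = {x \<in> V. j < d x}" for j by auto
    then show ?thesis using assms(1) by (simp add: sum.If_cases)
  qed
  finally show ?thesis .
qed

text \<open>Thresholds \<open>j\<close> that no \<open>d x\<close> exceeds contribute nothing to the
  sum over \<open>V\<close>, so the counts need comparing only where some \<open>x\<close> lies
  beyond \<open>j\<close>. Elsewhere \<open>card V = card W\<close> turns larger balls into smaller
  complements.\<close>

lemma sum_mono_card_le:
  fixes d :: "'a \<Rightarrow> nat" and f :: "'b \<Rightarrow> nat"
  assumes "finite V" "finite W" "card V = card W"
    and le: "\<And>j x. x \<in> V \<Longrightarrow> j < d x \<Longrightarrow> card {y \<in> W. f y \<le> j} \<le> card {x \<in> V. d x \<le> j}"
  shows "sum d V \<le> sum f W"
proof -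
  \<comment> \<open>Any common bound on \<open>d\<close> and \<open>f\<close> would serve: it lets
    both sums run over the same thresholds.\<close>
  define M where "M = sum d V + sum f W"
  have "d x \<le> M" if "x \<in> V" for x
    unfolding M_def using member_le_sum[of x V d] that assms(1) by simp
  moreover have "f y \<le> M" if "y \<in> W" for y
    unfolding M_def using member_le_sum[of y W f] that assms(2) by simp
  moreover have "card {x \<in> V. j < d x} \<le> card {y \<in> W. j < f y}" for j
  proof (cases "\<exists>x\<in>V. j < d x")
    case True
    have "{x \<in> V. j < d x} = V - {x \<in> V. d x \<le> j}" "{y \<in> W. j < f y} = W - {y \<in> W. f y \<le> j}"
      by auto
    then have "card {x \<in> V. j < d x} = card V - card {x \<in> V. d x \<le> j}"
      "card {y \<in> W. j < f y} = card W - card {y \<in> W. f y \<le> j}"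
      using assms(1,2) by (simp_all add: card_Diff_subset)
    with True le assms(3) show ?thesis by (auto intro!: diff_le_mono2)
  next
    case False
    then have "{x \<in> V. j < d x} = {}" by blast
    then show ?thesis by (simp only: card.empty le0)
  qed
  ultimately show ?thesis
    using assms(1,2) by (simp add: sum_eq_sum_card_less[of _ _ M] sum_mono)
qed

section \<open>Distances, layers and cut vertices\<close>

context pair_graph
begin

text \<open>The minimum defining \<open>graph_dist\<close> ranges over paths only; the unit-cost
  infimum \<open>\<mu>\<close> extends the bound to arbitrary walks.\<close>

lemma graph_dist_le_length:
  assumes "awalk u p w"
  shows "graph_dist G u w \<le> length p"
proof -
  have "u \<rightarrow>\<^sup>*\<^bsub>with_proj G\<^esub> w" using assms by (auto simp: reachable_awalk)
  then have "ereal (real (graph_dist G u w)) \<le> awalk_cost (\<lambda>_. 1) p"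
    using min_cost_le_walk_cost[OF assms] graph_dist_eq_mu by metis
  moreover have "awalk_cost (\<lambda>_. 1) p = real (length p)" by (induct p) auto
  ultimately show ?thesis by simp
qed

lemma graph_dist_awalkE:
  assumes "u \<rightarrow>\<^sup>*\<^bsub>with_proj G\<^esub> w"
  obtains p where "awalk u p w" "length p = graph_dist G u w"
proof -
  have "\<exists>l p. apath u p w \<and> length p = l" using assms by (auto simp: reachable_apath)
  then have "\<exists>p. apath u p w \<and> length p = graph_dist G u w"
    unfolding graph_dist_def by (rule LeastI_ex)
  then show ?thesis using that by (auto simp: apath_def)
qed

lemma graph_dist_self: "u \<in> pverts G \<Longrightarrow> graph_dist G u u = 0"
  using graph_dist_le_length[of u "[]" u] by (simp add: awalk_Nil_iff)

lemma graph_dist_arc_le: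
  assumes "u \<rightarrow>\<^sup>*\<^bsub>with_proj G\<^esub> x" "(x, y) \<in> parcs G"
  shows "graph_dist G u y \<le> Suc (graph_dist G u x)"
proof -
  obtain p where p: "awalk u p x" "length p = graph_dist G u x"
    using graph_dist_awalkE[OF assms(1)] .
  have "awalk x [(x, y)] y" using arc_implies_awalk[of "(x, y)"] assms(2) by simp
  from graph_dist_le_length[OF awalk_appendI[OF p(1) this]] show ?thesis using p(2) by simp
qed

text \<open>Drop the last arc of a shortest walk to \<open>y\<close>. What remains has length
  \<open>m\<close>, and a shorter walk to \<open>x\<close> would bring \<open>y\<close>
  closer.\<close>

lemma graph_dist_predE:
  assumes "u \<rightarrow>\<^sup>*\<^bsub>with_proj G\<^esub> y" "graph_dist G u y = Suc m"
  obtains x where "u \<rightarrow>\<^sup>*\<^bsub>with_proj G\<^esub> x" "(x, y) \<in> parcs G" "graph_dist G u x = m"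
proof -
  obtain p where p: "awalk u p y" "length p = Suc m"
    using graph_dist_awalkE[OF assms(1)] assms(2) by metis
  then obtain q e where q: "p = q @ [e]" by (cases p rule: rev_cases) auto
  define x where "x = fst e"
  have x: "awalk u q x" "(x, y) \<in> parcs G"
    using p(1) unfolding q x_def by (auto simp: awalk_Cons_iff awalk_Nil_iff)
  have r: "u \<rightarrow>\<^sup>*\<^bsub>with_proj G\<^esub> x" using x(1) by (auto simp: reachable_awalk)
  have "graph_dist G u x \<le> m" using graph_dist_le_length[OF x(1)] p(2) q by simp
  moreover have "Suc m \<le> Suc (graph_dist G u x)" using graph_dist_arc_le[OF r x(2)] assms(2) by simp
  ultimately show ?thesis using that r x(2) by simp
qed

lemma graph_dist_intermediate:
  assumes "u \<rightarrow>\<^sup>*\<^bsub>with_proj G\<^esub> y" "i \<le> graph_dist G u y"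
  shows "\<exists>x\<in>pverts G. graph_dist G u x = i"
  using assms
proof (induction "graph_dist G u y" arbitrary: y)
  case 0
  then show ?case using reachable_in_verts(2)[OF 0(2)] by (intro bexI[of _ y]) simp_all
next
  case (Suc m)
  show ?case
  proof (cases "i = Suc m")
    case True
    then show ?thesis
      using Suc.hyps(2) reachable_in_verts(2)[OF Suc.prems(1)] by (intro bexI[of _ y]) simp_all
  next
    case False
    obtain x where "u \<rightarrow>\<^sup>*\<^bsub>with_proj G\<^esub> x" "graph_dist G u x = m"
      using graph_dist_predE Suc.prems(1) Suc.hyps(2) by metis
    then show ?thesis using Suc.hyps(1)[of x] Suc.prems(2) Suc.hyps(2) False by simp
  qed
qed

text \<open>A potential that starts at 0 and grows by at most one per arc cannot outrun the
  distance. This gives lower bounds on distances without determining shortest walks.\<close>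

lemma lipschitz_le_graph_dist:
  assumes "u \<rightarrow>\<^sup>*\<^bsub>with_proj G\<^esub> w" "f u = (0::nat)"
    and "\<And>x y. (x, y) \<in> parcs G \<Longrightarrow> f y \<le> Suc (f x)"
  shows "f w \<le> graph_dist G u w"
  using assms(1)
proof (induction "graph_dist G u w" arbitrary: w)
  case 0
  obtain p where "awalk u p w" "length p = 0" using graph_dist_awalkE[OF 0(2)] 0(1) by metis
  then show ?case using assms(2) by (simp add: awalk_Nil_iff)
next
  case (Suc m)
  obtain x where "u \<rightarrow>\<^sup>*\<^bsub>with_proj G\<^esub> x" "(x, w) \<in> parcs G" "graph_dist G u x = m"
    using graph_dist_predE Suc by metis
  then show ?case using Suc.hyps assms(3)[of x w] by fastforce
qed

lemma connected_reachable:
  assumes "connected (with_proj G)" "u \<in> pverts G" "w \<in> pverts G"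
  shows "u \<rightarrow>\<^sup>*\<^bsub>with_proj G\<^esub> w"
  using symmetric_connected_imp_strongly_connected[OF sym_arcs assms(1)] assms(2,3) by auto

text \<open>Distance from \<open>u\<close> grows by at most one along an arc, so a walk from
  \<open>u\<close> to \<open>y\<close> must enter layer \<open>i\<close>, which it can do only at
  \<open>w\<close>. Deleting \<open>w\<close> therefore separates \<open>u\<close> from
  \<open>y\<close>.\<close>

lemma singleton_layer_cut_vertex:
  assumes conn: "connected (with_proj G)" and u: "u \<in> pverts G"
    and layer: "{x \<in> pverts G. graph_dist G u x = i} = {w}" and "1 \<le> i"
    and y: "y \<in> pverts G" "i < graph_dist G u y"
  shows "cut_vertex G w"
proof -
  define H where "H = del_vert w"
  have w: "w \<in> pverts G" "graph_dist G u w = i" using layer by auto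
  have "u \<noteq> w" "y \<noteq> w" using w y \<open>1 \<le> i\<close> graph_dist_self[OF u] by auto
  then have vH: "u \<in> verts H" "y \<in> verts H" using u y by (auto simp: H_def verts_del_vert)
  interpret H: wf_digraph H unfolding H_def by (rule wf_digraph_del_vert)
  interpret S: pair_wf_digraph "mk_symmetric H" by (rule H.wellformed_mk_symmetric)
  have "\<not> connected H"
  proof
    assume "connected H"
    \<comment> \<open>\<open>connected\<close> means strong connectedness of the symmetric closure,
      so the walk lives in \<open>mk_symmetric H\<close>; symmetry of \<open>G\<close> turns its
      arcs back into arcs of \<open>G\<close>.\<close>
    then have "u \<rightarrow>\<^sup>*\<^bsub>with_proj (mk_symmetric H)\<^esub> y"
      using vH by (auto simp: connected_def mk_symmetric_def)
    \<comment> \<open>Invariant along the walk: an arc from below layer \<open>i\<close> leads at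
      most to layer \<open>i\<close>, and the only vertex there has been deleted.\<close>
    then have "graph_dist G u y < i"
    proof (induction rule: S.reachable_induct)
      case base
      then show ?case using graph_dist_self[OF u] \<open>1 \<le> i\<close> by simp
    next
      case (step a b)
      have "(a, b) \<in> parcs (mk_symmetric H)" using step(2) by simp
      then have "((a, b) \<in> parcs G \<or> (b, a) \<in> parcs G) \<and> b \<noteq> w"
        unfolding parcs_mk_symmetric H_def del_vert_simps by auto
      then have "(a, b) \<in> parcs G" "b \<noteq> w"
        using pair_sym_arcs by (auto simp: symmetric_def elim: symE)
      moreover from this(1) have "a \<in> pverts G" "b \<in> pverts G"
        using arc_fst_in_verts arc_snd_in_verts by fastforce+
      ultimately have "graph_dist G u b \<le> i" "graph_dist G u b \<noteq> i"
        using graph_dist_arc_le[of u a b] connected_reachable[OF conn u] step(3) layer by auto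
      then show ?case by simp
    qed
    then show False using y(2) by simp
  qed
  then show ?thesis unfolding cut_vertex_def H_def using w u \<open>u \<noteq> w\<close> by auto
qed

text \<open>The vertex \<open>y\<close> makes layers 0 to \<open>j\<close> nonempty and layers 1 to
  \<open>j\<close> inner. Each layer contributes one vertex, and each inner layer that is not a
  singleton at least one more.\<close>

lemma card_ball_ge:
  assumes conn: "connected (with_proj G)" and u: "u \<in> pverts G"
    and y: "y \<in> pverts G" "j < graph_dist G u y"
  shows "j + 1 + (j - card {w. cut_vertex G w}) \<le> card {x \<in> pverts G. graph_dist G u x \<le> j}"
proof -
  define layer where "layer i = {x \<in> pverts G. graph_dist G u x = i}" for i
  define S where "S = {i \<in> {1..j}. card (layer i) = 1}"
  have fin: "finite (layer i)" for i by (simp add: layer_def)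
  \<comment> \<open>Mapping a cut vertex to its layer index covers \<open>S\<close>, so there are at
    most as many singleton inner layers as cut vertices.\<close>
  have "S \<subseteq> graph_dist G u ` {w. cut_vertex G w}"
  proof
    fix i assume "i \<in> S"
    then obtain w where w: "layer i = {w}" "1 \<le> i" "i \<le> j" 
      unfolding S_def by (auto simp: card_1_singleton_iff)
    then have "cut_vertex G w"
      using singleton_layer_cut_vertex[OF conn u _ w(2) y(1)] y(2) by (simp add: layer_def)
    moreover have "graph_dist G u w = i" using w(1) by (auto simp: layer_def)
    ultimately show "i \<in> graph_dist G u ` {w. cut_vertex G w}" by blast
  qed
  moreover have "finite {w. cut_vertex G w}"
    by (rule finite_subset[of _ "pverts G"]) (auto simp: cut_vertex_def)
  ultimately have S: "card S \<le> card {w. cut_vertex G w}" using surj_card_le by blast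
  have card_layer: "(if i \<in> {1..j} - S then 2 else 1) \<le> card (layer i)" if "i \<le> j" for i
  proof -
    have "layer i \<noteq> {}"
      using graph_dist_intermediate[OF connected_reachable[OF conn u y(1)], of i] that y(2)
      by (auto simp: layer_def)
    then have "0 < card (layer i)" using fin by (simp add: card_gt_0_iff)
    then show ?thesis unfolding S_def by auto
  qed
  have "j + 1 + (j - card S) = j + 1 + card ({1..j} - S)"
    by (subst card_Diff_subset) (auto simp: S_def)
  also have "\<dots> = (\<Sum>i\<le>j. if i \<in> {1..j} - S then 2 else 1)"
  proof -
    have "(\<Sum>i\<le>j. if i \<in> {1..j} - S then 2 else 1)
        = (\<Sum>i\<le>j. 1 + (if i \<in> {1..j} - S then 1 else 0))" by (rule sum.cong) auto
    also have "\<dots> = j + 1 + (\<Sum>i\<le>j. if i \<in> {1..j} - S then 1 else 0)"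
      by (subst sum.distrib) simp
    also have "(\<Sum>i\<le>j. if i \<in> {1..j} - S then 1 else 0) = card ({..j} \<inter> ({1..j} - S))"
      by (subst sum.inter_restrict[symmetric]) simp_all
    also have "{..j} \<inter> ({1..j} - S) = {1..j} - S" by auto
    finally show ?thesis by simp
  qed
  also have "\<dots> \<le> (\<Sum>i\<le>j. card (layer i))" using card_layer by (intro sum_mono) simp
  also have "\<dots> = card (\<Union>i\<le>j. layer i)"
    by (subst card_UN_disjoint) (use fin in \<open>auto simp: layer_def\<close>)
  also have "(\<Union>i\<le>j. layer i) = {x \<in> pverts G. graph_dist G u x \<le> j}" by (auto simp: layer_def)
  finally have "j + 1 + (j - card S) \<le> card {x \<in> pverts G. graph_dist G u x \<le> j}" .
  with add_left_mono[OF diff_le_mono2[OF S, of j], of "j + 1"] show ?thesis by (rule order.trans)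
qed

end

section \<open>Distances from the pendant vertex of \<open>L_graph\<close>\<close>

lemma L_reachable:
  assumes "3 \<le> g" "g < n" "x \<in> pverts (L_graph n g)"
  shows "Inl (n - g) \<rightarrow>\<^sup>*\<^bsub>with_proj (L_graph n g)\<^esub> x"
proof -
  interpret pair_graph "L_graph n g" using assms by (intro pair_graph_L)
  let ?z = "Inl (n - g) :: nat + nat"
  have step: "?z \<rightarrow>\<^sup>*\<^bsub>with_proj (L_graph n g)\<^esub> b"
    if "?z \<rightarrow>\<^sup>*\<^bsub>with_proj (L_graph n g)\<^esub> a" "(a, b) \<in> parcs (L_graph n g)" for a b
    using that by (auto intro: reachable_adj_trans)
  \<comment> \<open>No bound on \<open>i\<close> is imposed: truncated subtraction keeps the walk at
    \<open>Inl 0\<close>, where path and cycle meet.\<close>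
  have path: "?z \<rightarrow>\<^sup>*\<^bsub>with_proj (L_graph n g)\<^esub> Inl (n - g - i)" for i
  proof (induction i)
    case 0
    show ?case using L_verts[OF assms(1,2)] by auto
  next
    case (Suc i)
    show ?case
    proof (cases "i < n - g")
      case True
      have "(Inl (n - g - i), Inl (n - g - Suc i)) \<in> parcs (L_graph n g)"
        unfolding L_arcs[OF assms(1,2)] using True by (auto intro!: exI[of _ "n - g - Suc i"])
      then show ?thesis using step[OF Suc.IH] by blast
    next
      case False
      then show ?thesis using Suc.IH by simp
    qed
  qed
  \<comment> \<open>From \<open>Inl 0\<close> a single direction around the cycle reaches all its
    other vertices.\<close>
  have cycle: "?z \<rightarrow>\<^sup>*\<^bsub>with_proj (L_graph n g)\<^esub> Inr (Suc i)" if "Suc i < g" for i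
    using that
  proof (induction i)
    case 0
    have "(Inl 0, Inr (Suc 0)) \<in> parcs (L_graph n g)" unfolding L_arcs[OF assms(1,2)] by simp
    then show ?case using step[OF path[of "n - g"]] by simp
  next
    case (Suc i)
    have "(Inr (Suc i), Inr (Suc (Suc i))) \<in> parcs (L_graph n g)"
      unfolding L_arcs[OF assms(1,2)] using Suc.prems by auto
    then show ?case using step Suc by simp
  qed
  show ?thesis
  proof (cases x)
    case (Inl i)
    then have "i \<le> n - g" using assms(3) L_verts[OF assms(1,2)] by auto
    then have "n - g - (n - g - i) = i" by simp
    then show ?thesis using path[of "n - g - i"] unfolding Inl by (simp only:)
  next
    case (Inr i)
    then have "1 \<le> i" "i < g" using assms(3) L_verts[OF assms(1,2)] by auto
    then show ?thesis using cycle[of "i - 1"] Inr by simp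
  qed
qed

text \<open>Closed form of the distance from the pendant vertex \<open>Inl (n - g)\<close> on the
  vertices of \<open>L_graph n g\<close>: down the path to \<open>Inl 0\<close>, then the shorter
  way around the cycle.\<close>

definition L_level :: "nat \<Rightarrow> nat \<Rightarrow> nat + nat \<Rightarrow> nat" where
  "L_level n g x = (case x of Inl i \<Rightarrow> n - g - i | Inr i \<Rightarrow> n - g + min i (g - i))"

lemma L_level_le_graph_dist:
  assumes "3 \<le> g" "g < n" "x \<in> pverts (L_graph n g)"
  shows "L_level n g x \<le> graph_dist (L_graph n g) (Inl (n - g)) x"
proof -
  interpret pair_graph "L_graph n g" using assms by (intro pair_graph_L)
  show ?thesis
  proof (rule lipschitz_le_graph_dist[OF L_reachable[OF assms]])
    show "L_level n g (Inl (n - g)) = 0" by (simp add: L_level_def)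
    fix a b assume "(a, b) \<in> parcs (L_graph n g)"
    then show "L_level n g b \<le> Suc (L_level n g a)"
      unfolding L_arcs[OF assms(1,2)] L_level_def using assms(1) by auto
  qed
qed

text \<open>Up to level \<open>j\<close> the path shows at most its last \<open>j + 1\<close>
  vertices, and the cycle at most \<open>?m\<close> vertices on either side of \<open>Inl 0\<close>.
  The two cycle intervals may overlap, which only lowers the count.\<close>

lemma card_L_level_le:
  assumes "3 \<le> g" "g < n"
  shows "card {x \<in> pverts (L_graph n g). L_level n g x \<le> j} \<le> j + 1 + (j - (n - g))"
proof -
  let ?m = "j - (n - g)"
  have "{x \<in> pverts (L_graph n g). L_level n g x \<le> j}
      \<subseteq> Inl ` {n - g - j..n - g} \<union> Inr ` ({1..?m} \<union> {g - ?m..<g})" (is "?A \<subseteq> ?B")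
    unfolding L_verts[OF assms] L_level_def by (auto simp: image_iff)
  then have "card ?A \<le> card ?B" by (intro card_mono) auto
  also have "\<dots> \<le> card {n - g - j..n - g} + card ({1..?m} \<union> {g - ?m..<g})"
    by (rule order.trans[OF card_Un_le]) (simp add: card_image)
  also have "\<dots> \<le> card {n - g - j..n - g} + (card {1..?m} + card {g - ?m..<g})"
    using card_Un_le by (rule add_left_mono)
  also have "\<dots> \<le> card {n - g - j..n - g} + (?m + ?m)" by (intro add_left_mono add_mono) simp_all
  \<comment> \<open>Up to \<open>n - g\<close> the cycle part vanishes as \<open>?m = 0\<close>.
    Afterwards the path part stays at \<open>n - g + 1\<close>, and \<open>n - g + ?m = j\<close>
    absorbs one of the two \<open>?m\<close>.\<close>
  also have "\<dots> \<le> j + 1 + ?m" by (cases "j \<le> n - g") simp_all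
  finally show ?thesis .
qed

theorem theorem4p8:
  fixes n k :: nat
    and G :: "'a pair_pre_digraph"
    and z :: "nat + nat"
    and v :: 'a
  assumes "1 \<le> k" and "k + 3 \<le> n"
    and "pendant_vertex (L_graph n (n - k)) z"
    and "G \<in> conn_graphs n k"
    and "v \<in> pverts G"
  shows "vertex_distance G v \<le> vertex_distance (L_graph n (n - k)) z"
proof -
  define g where "g = n - k"
  have g: "3 \<le> g" "g < n" "n - g = k" using assms(1,2) by (auto simp: g_def)
  have z: "z = Inl (n - g)" using assms(3) pendant_L[OF g(1,2)] by (simp add: g_def)
  have conn: "connected (with_proj G)" and card: "card (pverts G) = n"
    and cut: "card {w. cut_vertex G w} = k" and "pair_graph G"
    using assms(4) by (auto simp: conn_graphs_def)
  interpret pair_graph G by fact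
  \<comment> \<open>The sum of levels serves as the middle term, so only the lower bound on
    distances in \<open>L_graph\<close> enters.\<close>
  have "vertex_distance G v \<le> sum (L_level n g) (pverts (L_graph n g))"
    unfolding vertex_distance_def
  proof (rule sum_mono_card_le)
    show "finite (pverts (L_graph n g))" using L_verts[OF g(1,2)] by simp
    show "card (pverts G) = card (pverts (L_graph n g))" using card card_L[OF g(1,2)] by simp
    \<comment> \<open>The two ball bounds coincide because the path length \<open>n - g\<close>
      equals the number \<open>k\<close> of cut vertices of \<open>G\<close>.\<close>
    fix j y assume "y \<in> pverts G" "j < graph_dist G v y"
    then show "card {x \<in> pverts (L_graph n g). L_level n g x \<le> j}
        \<le> card {x \<in> pverts G. graph_dist G v x \<le> j}"
      using card_ball_ge[OF conn assms(5)] card_L_level_le[OF g(1,2), of j] cut g(3)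
      by fastforce
  qed simp
  also have "\<dots> \<le> vertex_distance (L_graph n g) z"
    unfolding vertex_distance_def z
    using L_level_le_graph_dist[OF g(1,2)] by (rule sum_mono)
  finally show ?thesis by (simp add: g_def)
qed

end
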